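(* For integers $r,n$ with $1<r<n$ let $$G(r,n):=\frac{2\binom{r}{2}}{n^2}\sum_{k=r+1}^{n}\frac{n-k}{\binom{k-1}{2}},$$ and let $$\theta:=-\frac{1}{2W_{-1}\left(-\frac{1}{2\sqrt e}\right)}=e^{\frac12+W_{-1}\left(-\frac{1}{2\sqrt e}\right)}$$ be the solution with $0<x<1$ of the equation $2x\log x=x-1$. For $n\ge 3$, denote by $\mathcal{M}(n)$ a value of $r$ (integer, $1<r<n$) at which $G(\cdot,n)$ reaches its maximum. Then: i) $\displaystyle\lim_{n\to\infty}\frac{\mathcal{M}(n)}{n}=\theta=0.284668\ldots$, i.e. $\mathcal{M}(n)\sim n\theta$. ii) $\displaystyle\lim_{n\to\infty}G([n\theta],n)=\theta(1-\theta)=0.2036321\ldots$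
   Context: $[x]$ denotes the nearest integer to $x$. $W_{-1}$ is the real branch of the Lambert $W$ function (inverse of $w\mapsto we^w$) defined on $[-1/e,0)$ with values in $(-\infty,-1]$. $G(r,n)$ is the expected payoff in the best-or-worst secretary problem with $n$ objects when the first $r$ objects are rejected and then the first object better than all, or worse than all, preceding ones is chosen, the payoff being $(n-k)/n$ if the $k$-th object is chosen and it is the best or the worst of all, and $0$ otherwise. *)

theory Defs
  imports Complex_Main "HOL-Library.Landau_Symbols"
begin

text \<open>The real branch \<open>W\<^sub>-\<^sub>1\<close> of the Lambert function; only its values on \<open>[-1/e, 0)\<close> are
  meaningful, since there \<open>w \<mapsto> w e\<^sup>w\<close> is a decreasing bijection from \<open>(-\<infinity>, -1]\<close>.\<close>

definition lambert_Wm1 :: "real \<Rightarrow> real" where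
  "lambert_Wm1 = inv_into {..-1} (\<lambda>w. w * exp w)"

text \<open>Only used for \<open>1 < r < n\<close>; then every \<open>k\<close> in the range satisfies \<open>k - 1 \<ge> 2\<close>, so neither
  natural-number subtraction nor division by zero interferes.\<close>

definition G :: "nat \<Rightarrow> nat \<Rightarrow> real" where
  "G r n = 2 * real (r choose 2) / (real n)\<^sup>2
     * (\<Sum>k = r + 1..n. (real n - real k) / real ((k - 1) choose 2))"

definition theta :: real where
  "theta = - 1 / (2 * lambert_Wm1 (- 1 / (2 * sqrt (exp 1))))"

end

theory Submission
  imports Defs "HOL-Analysis.Harmonic_Numbers"
begin

text \<open>
  With \<open>x = r / n\<close>, partial fractions turn the sum in \<open>G r n\<close> into an elementary term minus
  a segment of the harmonic series, and that segment is \<open>ln (1 / x)\<close> up to \<open>1 / r\<close>. Hence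
  \<open>G r n\<close> differs from \<open>2 * x * (1 - x) + 2 * x\<^sup>2 * ln x\<close>, here called \<open>limit_payoff x\<close>, by at most
  \<open>3 / n\<close>, \<^emph>\<open>uniformly\<close> in \<open>1 < r < n\<close> (\<open>G_uniform_approx\<close>). The uniformity covers small \<open>r\<close>
  as well, because the error \<open>1 / r\<close> is multiplied by about \<open>x\<^sup>2\<close>.

  The derivative of \<open>limit_payoff\<close> is \<open>2 * x * slope_factor x\<close> with
  \<open>slope_factor x = 2 * ln x + 1 / x - 1\<close>, whose zeros are the solutions of
  \<open>2 * x * ln x = x - 1\<close>. The factor decreases up to \<open>1 / 2\<close>, then increases to its zero at \<open>1\<close>;
  so it has at most one zero below \<open>1\<close>, and it changes sign there from positive to negative. The
  substitution \<open>w = - 1 / (2 * x)\<close> turns this zero into a solution of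
  \<open>w * exp w = - 1 / (2 * sqrt e)\<close> with \<open>w \<le> -1\<close>, which identifies it with \<open>theta\<close>
  (\<open>theta_root\<close>). Therefore \<open>limit_payoff\<close> strictly increases up to \<open>theta\<close> and strictly
  decreases from there to \<open>1\<close>, and at \<open>theta\<close> the equation reduces it to
  \<open>theta * (1 - theta)\<close>.

  Uniform approximation gives the limit along \<open>r = [n * theta]\<close>. It also shows that a maximiser
  \<open>M n\<close>, which does at least as well as \<open>[n * theta]\<close>, has \<open>limit_payoff (M n / n)\<close> bounded
  below by a sequence tending to \<open>limit_payoff theta\<close>; by strict monotonicity on both sides
  this forces \<open>M n / n\<close> to tend to \<open>theta\<close>
  (\<open>tendsto_theta_if_limit_payoff_tendsto\<close>).
\<close>

section \<open>The critical equation\<close>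

definition slope_factor :: "real \<Rightarrow> real" where "slope_factor x = 2 * ln x + 1 / x - 1"

lemma slope_factor_eq_0_iff: "x > 0 \<Longrightarrow> slope_factor x = 0 \<longleftrightarrow> 2 * x * ln x = x - 1"
  by (auto simp: slope_factor_def field_simps)

lemma DERIV_slope_factor: "x > 0 \<Longrightarrow> (slope_factor has_real_derivative (2 * x - 1) / x\<^sup>2) (at x)"
  unfolding slope_factor_def
  by (auto intro!: derivative_eq_intros simp: field_simps power2_eq_square)

lemma slope_factor_strict_decreasing:
  assumes "0 < a" "a < b" "b \<le> 1 / 2"
  shows "slope_factor b < slope_factor a"
proof (rule DERIV_neg_imp_decreasing_open[OF \<open>a < b\<close>])
  fix x assume "a < x" "x < b"
  with assms show "\<exists>y. (slope_factor has_real_derivative y) (at x) \<and> y < 0"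
    by (intro exI[of _ "(2 * x - 1) / x\<^sup>2"]) (auto intro!: DERIV_slope_factor divide_neg_pos)
next
  show "continuous_on {a..b} slope_factor"
    using assms unfolding slope_factor_def by (auto intro!: continuous_intros)
qed

lemma slope_factor_neg:
  assumes "1 / 2 \<le> a" "a < 1"
  shows "slope_factor a < 0"
proof -
  have "slope_factor a < slope_factor 1"
  proof (rule DERIV_pos_imp_increasing_open[OF \<open>a < 1\<close>])
    fix x assume "a < x" "x < 1"
    with assms show "\<exists>y. (slope_factor has_real_derivative y) (at x) \<and> 0 < y"
      by (intro exI[of _ "(2 * x - 1) / x\<^sup>2"]) (auto intro!: DERIV_slope_factor divide_pos_pos)
  next
    show "continuous_on {a..1} slope_factor"
      using assms unfolding slope_factor_def by (auto intro!: continuous_intros)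
  qed
  thus ?thesis by (simp add: slope_factor_def)
qed

text \<open>
  A zero below \<open>1\<close> must lie below \<open>1 / 2\<close>, that is, on the decreasing branch.
\<close>

lemma slope_factor_root_sign:
  assumes "slope_factor t = 0" "0 < t" "t < 1"
  shows "0 < x \<Longrightarrow> x < t \<Longrightarrow> slope_factor x > 0"
    and "t < x \<Longrightarrow> x < 1 \<Longrightarrow> slope_factor x < 0"
proof -
  have t: "t < 1 / 2" using slope_factor_neg[of t] assms by force
  show "0 < x \<Longrightarrow> x < t \<Longrightarrow> slope_factor x > 0"
    using slope_factor_strict_decreasing[of x t] t assms by simp
  show "t < x \<Longrightarrow> x < 1 \<Longrightarrow> slope_factor x < 0"
    using slope_factor_strict_decreasing[of t x] slope_factor_neg[of x] assms by linarith
qed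

section \<open>Locating the zero and identifying it with theta\<close>

lemma ln_two_bounds: "ln (2 :: real) \<in> {0.6931471805..0.6931471806}"
  using ln_approx_bounds[of 2 10] by (simp add: lessThan_nat_numeral power_divide)

text \<open>
  The two fractions are simple rationals on either side of the zero \<open>0.28466813704\<dots>\<close>. The upper
  one has to be this close: seven digits of \<open>theta * (1 - theta) = 0.20363218879\<dots>\<close> leave only
  about \<open>2.6 * 10^(-8)\<close> of room above \<open>theta\<close>. Multiplying by \<open>4\<close> moves the arguments
  of \<open>ln\<close> near \<open>1\<close>, where three terms of the series suffice.
\<close>

lemma slope_factor_root_exists:
  obtains t where "slope_factor t = 0" "1205 / 4233 \<le> t" "t \<le> 2449 / 8603"
proof -
  have "ln (4820 / 4233 :: real) \<ge> 0.12986296"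
    using ln_approx_bounds[of "4820 / 4233" 3] by (simp add: lessThan_nat_numeral power_divide)
  moreover have "ln (1205 / 4233 :: real) = ln (4820 / 4233) - 2 * ln 2"
    using ln_div[of "4820 / 4233 :: real" "2 ^ 2"] ln_realpow[of 2 2] by simp
  ultimately have lo: "slope_factor (1205 / 4233) \<ge> 0"
    using ln_two_bounds unfolding slope_factor_def by simp
  have "ln (9796 / 8603 :: real) \<le> 0.12986316"
    using ln_approx_bounds[of "9796 / 8603" 3] by (simp add: lessThan_nat_numeral power_divide)
  moreover have "ln (2449 / 8603 :: real) = ln (9796 / 8603) - 2 * ln 2"
    using ln_div[of "9796 / 8603 :: real" "2 ^ 2"] ln_realpow[of 2 2] by simp
  ultimately have hi: "slope_factor (2449 / 8603) \<le> 0"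
    using ln_two_bounds unfolding slope_factor_def by simp
  have "continuous_on {1205 / 4233..2449 / 8603} slope_factor"
    unfolding slope_factor_def by (auto intro!: continuous_intros)
  from IVT2'[OF hi lo _ this] that show thesis by auto
qed

text \<open>
  The function \<open>w * exp w\<close> has derivative \<open>(1 + w) * exp w\<close>, negative below \<open>-1\<close>. Hence it is
  injective on the domain of the branch, and any preimage there is the chosen one.
\<close>

lemma lambert_Wm1_eqI:
  assumes "w \<le> -1" "w * exp w = y"
  shows "lambert_Wm1 y = w"
proof -
  have less: "v * exp v < u * exp u" if "u < v" "v \<le> -1" for u v :: real
  proof (rule DERIV_neg_imp_decreasing_open[OF \<open>u < v\<close>])
    fix x assume "u < x" "x < v"
    with that have "(1 + x) * exp x < 0" by (intro mult_neg_pos) auto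
    thus "\<exists>y. ((\<lambda>w. w * exp w) has_real_derivative y) (at x) \<and> y < 0"
      by (intro exI[of _ "(1 + x) * exp x"])
         (auto intro!: derivative_eq_intros simp: algebra_simps)
  qed (auto intro!: continuous_intros)
  have "inj_on (\<lambda>w::real. w * exp w) {..-1}"
  proof (rule linorder_inj_onI)
    fix u v :: real assume "u < v" "u \<in> {..-1}" "v \<in> {..-1}"
    thus "u * exp u \<noteq> v * exp v" using less[of u v] by auto
  qed auto
  from inv_into_f_f[OF this, of w] assms show ?thesis
    by (simp add: lambert_Wm1_def)
qed

lemma lambert_Wm1_slope_factor_root:
  assumes "slope_factor t = 0" "0 < t" "t \<le> 1 / 2"
  shows "lambert_Wm1 (- 1 / (2 * sqrt (exp 1))) = - 1 / (2 * t)"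
proof (rule lambert_Wm1_eqI)
  show "- 1 / (2 * t) \<le> - 1" using assms by (simp add: field_simps)
  have "- 1 / (2 * t) = ln t - 1 / 2" using assms unfolding slope_factor_def by (simp add: field_simps)
  hence "exp (- 1 / (2 * t)) = t / exp (1 / 2)" using assms by (simp add: exp_diff)
  moreover have "sqrt (exp 1) = exp (1 / 2)"
    by (rule real_sqrt_unique) (simp_all flip: exp_of_nat_mult)
  ultimately show "- 1 / (2 * t) * exp (- 1 / (2 * t)) = - 1 / (2 * sqrt (exp 1))"
    using assms by simp
qed

text \<open>
  Everything known about \<open>theta\<close> below comes from these facts rather than from the Lambert function.
\<close>

lemma theta_root: "slope_factor theta = 0" "1205 / 4233 \<le> theta" "theta \<le> 2449 / 8603"
  and theta_exp: "theta = exp (1 / 2 + lambert_Wm1 (- 1 / (2 * sqrt (exp 1))))"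
proof -
  obtain t where t: "slope_factor t = 0" "1205 / 4233 \<le> t" "t \<le> 2449 / 8603"
    by (rule slope_factor_root_exists)
  hence pos: "0 < t" by simp
  have W: "lambert_Wm1 (- 1 / (2 * sqrt (exp 1))) = - 1 / (2 * t)"
    using t by (intro lambert_Wm1_slope_factor_root) auto
  have th: "theta = t" unfolding theta_def W using pos by simp
  thus "slope_factor theta = 0" "1205 / 4233 \<le> theta" "theta \<le> 2449 / 8603" using t by simp_all
  have "1 / 2 + - 1 / (2 * t) = ln t" using t(1) pos unfolding slope_factor_def by (simp add: field_simps)
  thus "theta = exp (1 / 2 + lambert_Wm1 (- 1 / (2 * sqrt (exp 1))))"
    unfolding W th using pos by simp
qed

section \<open>Shape of the limiting payoff\<close>

definition limit_payoff :: "real \<Rightarrow> real" where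
  "limit_payoff x = 2 * x * (1 - x) + 2 * x\<^sup>2 * ln x"

lemma DERIV_limit_payoff:
  "x > 0 \<Longrightarrow> (limit_payoff has_real_derivative 2 * x * slope_factor x) (at x)"
  unfolding limit_payoff_def slope_factor_def
  by (auto intro!: derivative_eq_intros simp: field_simps power2_eq_square)

lemma limit_payoff_less_left:
  assumes "0 < a" "a < b" "b \<le> theta"
  shows "limit_payoff a < limit_payoff b"
proof (rule DERIV_pos_imp_increasing_open[OF \<open>a < b\<close>])
  fix x assume "a < x" "x < b"
  with assms show "\<exists>y. (limit_payoff has_real_derivative y) (at x) \<and> 0 < y"
    using slope_factor_root_sign(1)[OF theta_root(1), of x] theta_root
    by (intro exI[of _ "2 * x * slope_factor x"]) (auto intro!: DERIV_limit_payoff)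
qed (use assms in \<open>auto simp: limit_payoff_def intro!: continuous_intros\<close>)

lemma limit_payoff_less_right:
  assumes "theta \<le> a" "a < b" "b \<le> 1"
  shows "limit_payoff b < limit_payoff a"
proof (rule DERIV_neg_imp_decreasing_open[OF \<open>a < b\<close>])
  fix x assume "a < x" "x < b"
  with assms show "\<exists>y. (limit_payoff has_real_derivative y) (at x) \<and> y < 0"
    using slope_factor_root_sign(2)[OF theta_root(1), of x] theta_root
    by (intro exI[of _ "2 * x * slope_factor x"]) (auto intro!: DERIV_limit_payoff simp: mult_less_0_iff)
qed (use assms theta_root in \<open>auto simp: limit_payoff_def intro!: continuous_intros\<close>)

lemma limit_payoff_theta: "limit_payoff theta = theta * (1 - theta)"
proof -
  have "2 * theta * ln theta = theta - 1" using slope_factor_eq_0_iff theta_root by force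
  hence "theta * (2 * theta * ln theta) = theta * (theta - 1)" by simp
  thus ?thesis unfolding limit_payoff_def by (simp add: algebra_simps power2_eq_square)
qed

section \<open>Uniform approximation of the expected payoff\<close>

lemma real_choose_two: "real (n choose 2) = real n * (real n - 1) / 2"
  by (simp add: binomial_gbinomial gbinomial_prod_rev numeral_2_eq_2)

text \<open>
  The summand is \<open>2 * ((c - 2) / (k - 2) - (c - 1) / (k - 1))\<close>; splitting off \<open>1 / (k - 1)\<close>
  makes the rest telescope. Keeping the constant \<open>c\<close> (later \<open>n\<close>) apart from the upper limit
  \<open>m\<close> is what makes induction on \<open>m\<close> possible.
\<close>

lemma telescoping_payoff_sum:
  fixes c :: real
  assumes "2 \<le> r" "r \<le> m"
  shows "(\<Sum>k = r + 1..m. (c - real k) / real ((k - 1) choose 2)) =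
    2 * ((c - 2) * (1 / (real r - 1) - 1 / (real m - 1)) - (\<Sum>k = r..<m. 1 / real k))"
  using assms(2)
proof (induction m rule: dec_induct)
  case (step m)
  have m: "real m > 1" using step assms by simp
  have "(c - real (Suc m)) / real (m choose 2) =
      2 * ((c - 2) * (1 / (real m - 1) - 1 / real m) - 1 / real m)"
    using m by (simp add: real_choose_two divide_simps)
  thus ?case using step by (simp add: algebra_simps)
qed simp

lemma G_closed_form:
  assumes "1 < r" "r < n"
  shows "G r n = 2 * real r * (real n - 2) * (real n - real r) / ((real n)\<^sup>2 * (real n - 1))
    - 2 * real r * (real r - 1) / (real n)\<^sup>2 * (\<Sum>k = r..<n. 1 / real k)"
proof -
  have r: "real r - 1 > 0" "real n - 1 > 0" "real n > 0" using assms by auto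
  have cancel: "2 * (a * p) / N\<^sup>2 * (b * (c / (p * q)) - s)
      = 2 * a * b * c / (N\<^sup>2 * q) - 2 * a * p / N\<^sup>2 * s"
    if "p \<noteq> 0" "N \<noteq> 0" "q \<noteq> 0" for a b c p q s N :: real
    using that by (simp add: field_simps)
  have "1 / (real r - 1) - 1 / (real n - 1) = (real n - real r) / ((real r - 1) * (real n - 1))"
    using r by (simp add: field_simps)
  hence "G r n = 2 * (real r * (real r - 1)) / (real n)\<^sup>2 *
     ((real n - 2) * ((real n - real r) / ((real r - 1) * (real n - 1))) - (\<Sum>k = r..<n. 1 / real k))"
    unfolding G_def using telescoping_payoff_sum[of r n "real n"] assms
    by (simp add: real_choose_two)
  also have "\<dots> = 2 * real r * (real n - 2) * (real n - real r) / ((real n)\<^sup>2 * (real n - 1))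
    - 2 * real r * (real r - 1) / (real n)\<^sup>2 * (\<Sum>k = r..<n. 1 / real k)"
    using r cancel[of "real r - 1" "real n" "real n - 1"] by simp
  finally show ?thesis .
qed

text \<open>
  Each step rests on \<open>1 / (m + 1) \<le> ln ((m + 1) / m) \<le> 1 / m\<close>, both sides of which are instances of
  \<open>ln y \<le> y - 1\<close>.
\<close>

lemma harmonic_segment_bounds:
  assumes "0 < r" "r \<le> n"
  shows "ln (real n / real r) \<le> (\<Sum>k = r..<n. 1 / real k)"
    and "(\<Sum>k = r..<n. 1 / real k) \<le> ln (real n / real r) + 1 / real r - 1 / real n"
proof -
  have "ln (real n / real r) \<le> (\<Sum>k = r..<n. 1 / real k) \<and>
     (\<Sum>k = r..<n. 1 / real k) \<le> ln (real n / real r) + 1 / real r - 1 / real n"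
    using assms(2)
  proof (induction n rule: dec_induct)
    case (step m)
    have m: "real m > 0" using step assms by simp
    have up: "ln (real (Suc m) / real m) \<le> 1 / real m"
      using ln_le_minus_one[of "real (Suc m) / real m"] m by (simp add: field_simps)
    have "ln (real m / real (Suc m)) \<le> - 1 / real (Suc m)"
      using ln_le_minus_one[of "real m / real (Suc m)"] m by (simp add: field_simps)
    hence lo: "1 / real (Suc m) \<le> ln (real (Suc m) / real m)"
      using m by (simp add: ln_div)
    have "ln (real (Suc m) / real r) = ln (real m / real r) + ln (real (Suc m) / real m)"
      using m assms by (simp add: ln_div)
    thus ?case using step up lo by simp
  qed (use assms in simp)
  thus "ln (real n / real r) \<le> (\<Sum>k = r..<n. 1 / real k)"
    "(\<Sum>k = r..<n. 1 / real k) \<le> ln (real n / real r) + 1 / real r - 1 / real n" by auto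
qed

text \<open>
  Writing \<open>S\<close> for the harmonic segment and \<open>L = ln (n / r)\<close>, the difference is
  \<open>2 * x * S / n - 2 * x * (1 - x) / (n - 1) - 2 * x\<^sup>2 * (S - L)\<close>. Since \<open>x * S \<le> 1\<close>,
  \<open>x * (1 - x) \<le> 1 / 4\<close> and \<open>x\<^sup>2 * (S - L) \<le> 1 / n\<close>, it lies between \<open>- 3 / n\<close> and \<open>2 / n\<close>.
\<close>

lemma G_uniform_approx:
  assumes "1 < r" "r < n"
  shows "\<bar>G r n - limit_payoff (real r / real n)\<bar> \<le> 3 / real n"
proof -
  define x where "x = real r / real n"
  define N where "N = real n"
  define S where "S = (\<Sum>k = r..<n. 1 / real k)"
  define L where "L = ln (real n / real r)"
  have N: "N \<ge> 3" and x: "0 < x" "x < 1" and r: "real r = x * N"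
    using assms by (auto simp: N_def x_def)
  have lnx: "ln x = - L" using assms by (simp add: x_def L_def ln_div)
  have SL: "L \<le> S" "S \<le> L + 1 / (x * N) - 1 / N"
    using harmonic_segment_bounds[of r n] assms
    unfolding S_def L_def r[symmetric] N_def[symmetric] by simp_all
  have "L \<le> 1 / x - 1"
    using ln_le_minus_one[of "real n / real r"] assms unfolding L_def x_def by simp
  hence xL: "x * L \<le> 1 - x" using mult_left_mono[of L "1 / x - 1" x] x by (simp add: algebra_simps)
  have L0: "L \<ge> 0" unfolding L_def using assms by simp
  have "x * (S - L) \<le> x * (1 / (x * N) - 1 / N)" using SL x by (intro mult_left_mono) auto
  also have "\<dots> = 1 / N - x / N" using x N by (simp add: right_diff_distrib)
  finally have xSL: "x * (S - L) \<le> 1 / N - x / N" .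
  have xN: "0 \<le> x / N" "1 / N \<le> x"
    using x N assms unfolding N_def x_def by (auto simp: field_simps)
  have "x * (x * (S - L)) \<le> x * (S - L)" using x SL by (intro mult_left_le_one_le) auto
  hence x2: "x * (x * (S - L)) \<le> 1 / N" using xSL xN by linarith
  have "G r n = 2 * (x * N) * (N - 2) * (N - x * N) / (N\<^sup>2 * (N - 1))
      - 2 * (x * N) * (x * N - 1) / N\<^sup>2 * S"
    using G_closed_form[OF assms] unfolding S_def[symmetric] r N_def[symmetric] .
  also have "\<dots> = 2 * x * (1 - x) - 2 * (x * (1 - x)) / (N - 1) - 2 * x * x * S + 2 * (x * S) / N"
    using N by (simp add: divide_simps power2_eq_square) (simp add: algebra_simps)
  finally have diff: "G r n - limit_payoff x =
      2 * (x * S) / N - 2 * (x * (1 - x)) / (N - 1) - 2 * (x * (x * (S - L)))"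
    unfolding limit_payoff_def lnx by (simp add: algebra_simps power2_eq_square)
  have "x * S \<le> 1" using xSL xL xN unfolding right_diff_distrib by linarith
  hence a: "2 * (x * S) / N \<le> 2 / N" "0 \<le> 2 * (x * S) / N"
    using N x SL L0 by (auto simp: field_simps)
  have "x * (1 - x) \<le> 1 / 4" using sum_squares_ge_zero[of "x - 1/2" 0] by (simp add: algebra_simps)
  hence "2 * (x * (1 - x)) / (N - 1) \<le> (1 / 2) / (N - 1)" using N by (intro divide_right_mono) auto
  also have "\<dots> \<le> 1 / N" using N by (simp add: field_simps)
  finally have b: "2 * (x * (1 - x)) / (N - 1) \<le> 1 / N" "0 \<le> 2 * (x * (1 - x)) / (N - 1)"
    using N x by auto
  have c: "0 \<le> x * (x * (S - L))" using x SL by simp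
  have "2 / N = 2 * (1 / N)" "3 / N = 3 * (1 / N)" by simp_all
  hence "\<bar>G r n - limit_payoff x\<bar> \<le> 3 / N" using a b c x2 diff by linarith
  thus ?thesis by (simp add: x_def N_def)
qed

section \<open>Passage to the limit\<close>

definition rounded_theta :: "nat \<Rightarrow> nat" where "rounded_theta n = nat (round (real n * theta))"

lemma rounded_theta_lim: "(\<lambda>n. real (rounded_theta n) / real n) \<longlonglongrightarrow> theta"
  and rounded_theta_range: "eventually (\<lambda>n. 1 < rounded_theta n \<and> rounded_theta n < n) sequentially"
proof -
  have near: "\<bar>real (rounded_theta n) - real n * theta\<bar> \<le> 1 / 2" for n
  proof -
    have "round (real n * theta) \<ge> 0" using theta_root(2) by (simp add: round_def)
    thus ?thesis using of_int_round_abs_le[of "real n * theta"]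
      unfolding rounded_theta_def by (simp add: of_nat_nat)
  qed
  have "(\<lambda>n. real (rounded_theta n) / real n - theta) \<longlonglongrightarrow> 0"
  proof (rule Lim_null_comparison[OF _ lim_const_over_n])
    show "eventually (\<lambda>n. norm (real (rounded_theta n) / real n - theta) \<le> (1 / 2) / real n) sequentially"
      using eventually_gt_at_top[of 0]
    proof eventually_elim
      case (elim n)
      hence "real (rounded_theta n) / real n - theta = (real (rounded_theta n) - real n * theta) / real n"
        by (simp add: field_simps)
      hence "norm (real (rounded_theta n) / real n - theta) = \<bar>real (rounded_theta n) - real n * theta\<bar> / real n"
        by simp
      also have "\<dots> \<le> (1 / 2) / real n" using near[of n] by (intro divide_right_mono) auto
      finally show ?case .
    qed
  qed
  thus lim: "(\<lambda>n. real (rounded_theta n) / real n) \<longlonglongrightarrow> theta" by (simp add: LIM_zero_iff)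
  show "eventually (\<lambda>n. 1 < rounded_theta n \<and> rounded_theta n < n) sequentially"
    using eventually_ge_at_top[of 10]
  proof eventually_elim
    case (elim n)
    \<comment> \<open>From \<open>n = 10\<close> on, \<open>n / 5 - 1 / 2 > 1\<close> and \<open>3 * n / 10 + 1 / 2 < n\<close>.\<close>
    have "real n * (1 / 5) \<le> real n * theta" "real n * theta \<le> real n * (3 / 10)"
      using theta_root by (intro mult_left_mono; simp)+
    thus ?case using near[of n] elim by linarith
  qed
qed

lemma isCont_limit_payoff: "x > 0 \<Longrightarrow> isCont limit_payoff x"
  using DERIV_limit_payoff DERIV_isCont by blast

lemma G_rounded_theta_lim: "(\<lambda>n. G (rounded_theta n) n) \<longlonglongrightarrow> limit_payoff theta"
proof -
  have "(\<lambda>n. G (rounded_theta n) n - limit_payoff (real (rounded_theta n) / real n)) \<longlonglongrightarrow> 0"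
    by (rule Lim_null_comparison[OF _ lim_const_over_n[of 3]])
       (use rounded_theta_range in eventually_elim, use G_uniform_approx in auto)
  moreover have "(\<lambda>n. limit_payoff (real (rounded_theta n) / real n)) \<longlonglongrightarrow> limit_payoff theta"
    using theta_root(2) by (intro isCont_tendsto_compose[OF isCont_limit_payoff] rounded_theta_lim) simp
  ultimately show ?thesis using tendsto_add by fastforce
qed

text \<open>
  A value \<open>f n\<close> at a fixed distance or more from \<open>theta\<close> would keep \<open>limit_payoff (f n)\<close> at or below its
  value at a fixed point on the same side, which is strictly less than the maximum.
\<close>

lemma tendsto_theta_if_limit_payoff_tendsto:
  assumes range: "eventually (\<lambda>n. 0 < f n \<and> f n < 1) F"
    and lower: "eventually (\<lambda>n. h n \<le> limit_payoff (f n)) F"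
    and lim: "(h \<longlongrightarrow> limit_payoff theta) F"
  shows "(f \<longlongrightarrow> theta) F"
proof (rule order_tendstoI)
  fix a assume a: "a < theta"
  \<comment> \<open>Half of \<open>theta\<close> keeps the comparison point positive when \<open>a\<close> is not.\<close>
  define b where "b = max a (theta / 2)"
  have b: "0 < b" "b < theta" "a \<le> b" using a theta_root(2) by (auto simp: b_def)
  from limit_payoff_less_left[of b theta] b have "limit_payoff b < limit_payoff theta" by simp
  from order_tendstoD(1)[OF lim this] range lower show "eventually (\<lambda>n. a < f n) F"
  proof eventually_elim
    case (elim n)
    thus ?case using limit_payoff_less_left[of "f n" b] b by (cases "f n < b"; cases "f n = b") auto
  qed
next
  fix a assume a: "theta < a"
  define b where "b = min a 1"
  have b: "theta < b" "b \<le> 1" "b \<le> a" using a theta_root(3) by (auto simp: b_def)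
  from limit_payoff_less_right[of theta b] b have "limit_payoff b < limit_payoff theta" by simp
  from order_tendstoD(1)[OF lim this] range lower show "eventually (\<lambda>n. f n < a) F"
  proof eventually_elim
    case (elim n)
    thus ?case using limit_payoff_less_right[of b "f n"] b by (cases "b < f n"; cases "f n = b") auto
  qed
qed

lemma argmax_ratio_lim:
  assumes M: "\<And>n. n \<ge> 3 \<Longrightarrow> is_arg_max (\<lambda>r. G r n) (\<lambda>r. 1 < r \<and> r < n) (M n)"
  shows "(\<lambda>n. real (M n) / real n) \<longlonglongrightarrow> theta"
proof (rule tendsto_theta_if_limit_payoff_tendsto)
  show "eventually (\<lambda>n. 0 < real (M n) / real n \<and> real (M n) / real n < 1) sequentially"
    using eventually_ge_at_top[of 3]
    by eventually_elim (use M in \<open>force simp: is_arg_max_def\<close>)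
  show "eventually (\<lambda>n. G (rounded_theta n) n - 3 / real n \<le> limit_payoff (real (M n) / real n)) sequentially"
    using eventually_ge_at_top[of 3] rounded_theta_range
  proof eventually_elim
    case (elim n)
    hence "1 < M n" "M n < n" "G (rounded_theta n) n \<le> G (M n) n"
      using M[of n] unfolding is_arg_max_linorder by auto
    with G_uniform_approx[of "M n" n] show ?case by linarith
  qed
  show "(\<lambda>n. G (rounded_theta n) n - 3 / real n) \<longlonglongrightarrow> limit_payoff theta"
    using tendsto_diff[OF G_rounded_theta_lim lim_const_over_n[of 3]] by simp
qed

theorem theorem7:
  fixes M :: "nat \<Rightarrow> nat"
  assumes "\<And>n. n \<ge> 3 \<Longrightarrow> is_arg_max (\<lambda>r. G r n) (\<lambda>r. 1 < r \<and> r < n) (M n)"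
  shows "(theta = exp (1 / 2 + lambert_Wm1 (- 1 / (2 * sqrt (exp 1))))
          \<and> (\<forall>x::real. (0 < x \<and> x < 1 \<and> 2 * x * ln x = x - 1) \<longleftrightarrow> x = theta))
       \<and> ((\<lambda>n. real (M n) / real n) \<longlonglongrightarrow> theta
          \<and> (\<lambda>n. real (M n)) \<sim>[at_top] (\<lambda>n. real n * theta)
          \<and> 0.284668 \<le> theta \<and> theta < 0.284669)
       \<and> ((\<lambda>n. G (nat (round (real n * theta))) n) \<longlonglongrightarrow> theta * (1 - theta)
          \<and> 0.2036321 \<le> theta * (1 - theta) \<and> theta * (1 - theta) < 0.2036322)"
proof -
  note [simp] = theta_root(1)
  have pos: "0 < theta" "theta < 1" using theta_root by auto
  have unique: "(0 < x \<and> x < 1 \<and> 2 * x * ln x = x - 1) \<longleftrightarrow> x = theta" for x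
    using slope_factor_eq_0_iff[of x] slope_factor_root_sign[OF theta_root(1) pos, of x] pos
    by (cases x theta rule: linorder_cases) auto
  have lim: "(\<lambda>n. real (M n) / real n) \<longlonglongrightarrow> theta"
    by (rule argmax_ratio_lim) (rule assms)
  have equiv: "(\<lambda>n. real (M n)) \<sim>[at_top] (\<lambda>n. real n * theta)"
  proof (rule asymp_equivI')
    show "(\<lambda>n. real (M n) / (real n * theta)) \<longlonglongrightarrow> 1"
      using tendsto_divide[OF lim tendsto_const[of theta]] pos by simp
  qed
  \<comment> \<open>The bracket for \<open>theta\<close> transfers to \<open>theta * (1 - theta)\<close> since \<open>t * (1 - t)\<close> increases up to \<open>1 / 2\<close>.\<close>
  have mono: "s * (1 - s) \<le> t * (1 - t)" if "s \<le> t" "t \<le> 1 / 2" for s t :: real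
  proof -
    have "0 \<le> (t - s) * (1 - t - s)" using that by (intro mult_nonneg_nonneg) auto
    thus ?thesis by (simp add: algebra_simps)
  qed
  have "0.2036321 \<le> theta * (1 - theta)" "theta * (1 - theta) < 0.2036322"
    using mono[of "1205 / 4233" theta] mono[of theta "2449 / 8603"] theta_root by auto
  thus ?thesis
    using theta_exp unique lim equiv G_rounded_theta_lim theta_root
    by (auto simp: limit_payoff_theta rounded_theta_def)
qed

end
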